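(* Let $k,d$ be positive integers and let $\Gamma$ be a finite, simple, strongly connected digraph with $\dim(\Gamma)=k$ and diameter $d$. Then $$k+d\leq |A(\Gamma)|\leq \Big(\frac{d^2+3d-2}{2}\Big)^{2k}+(2k-d)d^{2k-1}+k^2-k.$$ Moreover: (i) the lower bound is attained if and only if $k=1$ and $\Gamma$ is isomorphic to a directed cycle of length $d+1$; (ii) the upper bound is attained if and only if one of the following holds: (a) $k=1$ and $\Gamma$ is isomorphic to $\Gamma(d^2+1,d)$; (b) $d=1$ and $\Gamma$ is isomorphic to the complete digraph of order $k+1$; (c) $d=2$ and $\Gamma$ is isomorphic to $\overline{\Gamma}(4^k+k,2)$.
   Context: All digraphs are finite, simple (no loops, at most one arc per ordered pair) and strongly connected; $A(\Gamma)$ is the arc set. $\partial(x,y)$ is the length of a shortest directed path from $x$ to $y$, $\tilde\partial(x,y)=(\partial(x,y),\partial(y,x))$, and the diameter is $\max_{x,y}\partial(x,y)$. A set $\{w_1,\dots,w_m\}\subseteq V(\Gamma)$ is weakly resolving if $(\tilde\partial(w_1,u),\dots,\tilde\partial(w_m,u))\neq(\tilde\partial(w_1,v),\dots,\tilde\partial(w_m,v))$ for all distinct $u,v$; $\dim(\Gamma)$ is the minimum size of a weakly resolving set. The complete digraph has every ordered pair of distinct vertices as an arc. For positive integers $k,d$, the digraph $\Gamma(d^{2k}+k,d)$ has vertex set $\{u_1,\dots,u_k\}\cup\{1,\dots,d\}^{2k}$ (the $u_i$ are $k$ extra vertices, the others are $2k$-tuples), and its arcs are exactly: (F1) $(u_i,(a_1,\dots,a_{2k}))$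 whenever $a_{2i-1}=1$; (F2) $((a_1,\dots,a_{2k}),u_i)$ whenever $a_{2i}=1$; (F3) $((a_1,\dots,a_{2k}),(b_1,\dots,b_{2k}))$ whenever the tuples are distinct and $a_{2r-1}-b_{2r-1}\geq -1$ and $a_{2r}-b_{2r}\leq 1$ for every $r=1,\dots,k$. (There are no arcs between distinct $u_i,u_j$.) The digraph $\overline{\Gamma}(d^{2k}+k,d)$ is obtained from $\Gamma(d^{2k}+k,d)$ by adding both arcs $(u_i,u_j)$ and $(u_j,u_i)$ for all $1\leq i<j\leq k$. *)

theory Defs
  imports Complex_Main "HOL-Library.FuncSet" "Graph_Theory.Graph_Theory"
begin

context pre_digraph
begin

text \<open>Only meaningful if \<open>v\<close> is reachable from \<open>u\<close>.\<close>

definition ddist :: "'a \<Rightarrow> 'a \<Rightarrow> nat" where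
  "ddist u v = (LEAST n. \<exists>p. apath u p v \<and> length p = n)"

definition two_way_dist :: "'a \<Rightarrow> 'a \<Rightarrow> nat \<times> nat" where
  "two_way_dist u v = (ddist u v, ddist v u)"

definition diam :: nat where
  "diam = Max {ddist u v | u v. u \<in> verts G \<and> v \<in> verts G}"

definition weakly_resolving :: "'a set \<Rightarrow> bool" where
  "weakly_resolving W \<longleftrightarrow> finite W \<and> W \<subseteq> verts G \<and>
    (\<forall>u\<in>verts G. \<forall>v\<in>verts G. u \<noteq> v \<longrightarrow> (\<exists>w\<in>W. two_way_dist w u \<noteq> two_way_dist w v))"

definition weak_dim :: nat where
  "weak_dim = (LEAST m. \<exists>W. weakly_resolving W \<and> card W = m)"

end

definition directed_cycle :: "nat \<Rightarrow> nat pair_pre_digraph" where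
  "directed_cycle n = \<lparr> pverts = {..<n}, parcs = {(i, Suc i mod n) | i. i < n} \<rparr>"

definition standard_complete :: "nat \<Rightarrow> nat pair_pre_digraph" where
  "standard_complete n = \<lparr> pverts = {..<n}, parcs = {(i, j). i < n \<and> j < n \<and> i \<noteq> j} \<rparr>"

lemma complete_digraph_standard_complete:
  "complete_digraph n (with_proj (standard_complete n))"
  unfolding complete_digraph_pair_def by (auto simp: standard_complete_def)

datatype gamma_vertex = U nat | Tup "nat \<Rightarrow> nat"

text \<open>A tuple \<open>(a\<^sub>1, \<dots>, a\<^sub>2\<^sub>k)\<close> is a function that is \<open>undefined\<close> outside \<open>{1..2 * k}\<close>.\<close>

definition tuples :: "nat \<Rightarrow> nat \<Rightarrow> (nat \<Rightarrow> nat) set" where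
  "tuples k d = {1..2 * k} \<rightarrow>\<^sub>E {1..d}"

text \<open>\<open>Gamma_digraph k d\<close> is $\Gamma(d^{2k}+k,d)$ and \<open>Gamma_bar_digraph k d\<close> is
  $\overline{\Gamma}(d^{2k}+k,d)$.\<close>

definition Gamma_digraph :: "nat \<Rightarrow> nat \<Rightarrow> gamma_vertex pair_pre_digraph" where
  "Gamma_digraph k d = \<lparr>
    pverts = U ` {1..k} \<union> Tup ` tuples k d,
    parcs =
      {(U i, Tup a) | i a. i \<in> {1..k} \<and> a \<in> tuples k d \<and> a (2 * i - 1) = 1}
      \<union> {(Tup a, U i) | i a. i \<in> {1..k} \<and> a \<in> tuples k d \<and> a (2 * i) = 1}
      \<union> {(Tup a, Tup b) | a b. a \<in> tuples k d \<and> b \<in> tuples k d \<and> a \<noteq> b \<and>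
          (\<forall>r\<in>{1..k}. int (a (2 * r - 1)) - int (b (2 * r - 1)) \<ge> -1 \<and>
                      int (a (2 * r)) - int (b (2 * r)) \<le> 1)} \<rparr>"

definition Gamma_bar_digraph :: "nat \<Rightarrow> nat \<Rightarrow> gamma_vertex pair_pre_digraph" where
  "Gamma_bar_digraph k d = \<lparr>
    pverts = pverts (Gamma_digraph k d),
    parcs = parcs (Gamma_digraph k d) \<union>
      {(U i, U j) | i j. i \<in> {1..k} \<and> j \<in> {1..k} \<and> i \<noteq> j} \<rparr>"

end

theory Submission
  imports Defs
begin

text \<open>Upper bound: fix a minimum weakly resolving set \<open>w\<^sub>1, \<dots>, w\<^sub>k\<close>. Sending \<open>w\<^sub>i\<close> to \<open>u\<^sub>i\<close> and every other
  vertex \<open>x\<close> to the tuple of all distances \<open>\<partial>(w\<^sub>i, x)\<close>, \<open>\<partial>(x, w\<^sub>i)\<close> embeds the digraph into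
  $\overline{\Gamma}(d^{2k}+k,d)$, whose number of arcs is exactly the bound; so equality means that the
  embedding is an isomorphism. If \<open>k \<ge> 2\<close> and \<open>d \<ge> 3\<close> this is impossible, since the arcs
  \<open>w\<^sub>2 \<rightarrow> w\<^sub>1 \<rightarrow> x\<close> exclude a tuple with \<open>\<partial>(w\<^sub>1, x) = 1\<close> and \<open>\<partial>(w\<^sub>2, x) = 3\<close>.

  Lower bound: removing the last \<open>d\<close> vertices of a geodesic of length \<open>d\<close> leaves a weakly resolving set, so
  there are at least \<open>k + d\<close> vertices, each with an outgoing arc.\<close>

section \<open>Isomorphisms and arc counts\<close>

lemma digraph_iso_card_arcs:
  assumes "digraph_iso G H"
  shows "card (arcs G) = card (arcs H)"
  using assms unfolding digraph_iso_def
  by (auto simp: card_image pre_digraph.digraph_isomorphism_inj_on_arcs)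

text \<open>Without parallel arcs, each arc can be renamed to the pair of images of its endpoints
  without collisions. So a vertex bijection that matches the arc pairs suffices, whatever the type
  of the arcs of \<open>G\<close>.\<close>

lemma (in nomulti_digraph) digraph_iso_pairI:
  assumes bij: "bij_betw f (verts G) (pverts H)"
    and arcs: "map_prod f f ` arcs_ends G = parcs H"
  shows "digraph_iso G (with_proj H)"
proof -
  define hom where "hom = \<lparr>iso_verts = f, iso_arcs = (\<lambda>e. (f (tail G e), f (head G e))),
    iso_head = snd, iso_tail = fst\<rparr>"
  have inj: "inj_on f (verts G)" using bij by (rule bij_betw_imp_inj_on)
  have "inj_on (iso_arcs hom) (arcs G)"
  proof (rule inj_onI)
    fix e1 e2 assume e: "e1 \<in> arcs G" "e2 \<in> arcs G" "iso_arcs hom e1 = iso_arcs hom e2"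
    then have "tail G e1 = tail G e2" "head G e1 = head G e2"
      using inj by (auto simp: hom_def dest: inj_onD)
    then show "e1 = e2" using e by (auto intro: no_multi_arcs simp: arc_to_ends_def)
  qed
  then have "digraph_isomorphism hom"
    using inj wf_digraph unfolding digraph_isomorphism_def by (simp add: hom_def)
  moreover have "with_proj H = app_iso hom G"
    using bij_betw_imp_surj_on[OF bij] arcs
    unfolding with_proj_def app_iso_def hom_def arcs_ends_conv by (auto simp: image_image)
  ultimately show ?thesis unfolding digraph_iso_def by blast
qed

lemma (in nomulti_digraph) card_arcs_ends: "card (arcs_ends G) = card (arcs G)"
  unfolding arcs_ends_def by (rule card_image) (rule inj_on_arc_to_ends)

lemma card_parcs_directed_cycle: "card (parcs (directed_cycle n)) = n"
proof -
  have "parcs (directed_cycle n) = (\<lambda>i. (i, Suc i mod n)) ` {..<n}"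
    by (auto simp: directed_cycle_def)
  then show ?thesis by (simp add: card_image inj_on_def)
qed

subsection \<open>Distances in strongly connected digraphs\<close>

locale strong_digraph = digraph G for G :: "('a, 'b) pre_digraph" (structure) +
  assumes strongly_connected: "strongly_connected G"
begin

lemma verts_nonempty: "verts G \<noteq> {}"
  using strongly_connected by (simp add: strongly_connected_def)

lemma ex_awalk:
  assumes "u \<in> verts G" "v \<in> verts G"
  shows "\<exists>p. awalk u p v"
  using strongly_connected assms by (auto simp: strongly_connected_def reachable_awalk)

text \<open>\<open>ddist\<close> minimises over paths, whereas concatenation only yields walks. A
  walk that repeats a vertex contains a nonempty closed part, and cutting it out shortens the
  walk.\<close>

lemma shorter_apath:
  assumes "awalk u p v"
  shows "\<exists>q. apath u q v \<and> length q \<le> length p"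
  using assms
proof (induction "length p" arbitrary: p rule: less_induct)
  case less
  show ?case
  proof (cases "distinct (awalk_verts u p)")
    case True
    then show ?thesis using less.prems by (auto simp: apath_def)
  next
    case False
    then obtain q r s where "p = q @ r @ s" "r \<noteq> []" and w: "\<exists>w. awalk u q w \<and> awalk w r w \<and> awalk w s v"
      using awalk_not_distinct_decomp[OF less.prems] by blast
    then show ?thesis
      using less.hyps[of "q @ s"] by (fastforce dest: awalk_appendI)
  qed
qed

lemma ddist_le:
  assumes "awalk u p v"
  shows "ddist u v \<le> length p"
proof -
  obtain q where q: "apath u q v" "length q \<le> length p" using shorter_apath[OF assms] by blast
  have "ddist u v \<le> length q" unfolding ddist_def by (rule Least_le) (use q in blast)
  then show ?thesis using q by simp
qed

lemma ddist_attained: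
  assumes "u \<in> verts G" "v \<in> verts G"
  obtains p where "awalk u p v" "length p = ddist u v"
proof -
  obtain q where "apath u q v" using ex_awalk[OF assms] shorter_apath by blast
  then have "\<exists>n p. apath u p v \<and> length p = n" by blast
  then have "\<exists>p. apath u p v \<and> length p = ddist u v" unfolding ddist_def by (rule LeastI_ex)
  then show ?thesis using that by (auto simp: apath_def)
qed

lemma ddist_eq_0_iff:
  assumes "u \<in> verts G" "v \<in> verts G"
  shows "ddist u v = 0 \<longleftrightarrow> u = v"
proof
  assume "ddist u v = 0"
  with ddist_attained[OF assms] show "u = v" by (metis length_0_conv awalk_empty_ends)
next
  assume "u = v"
  then show "ddist u v = 0" using ddist_le[of u "[]" v] assms by (simp add: awalk_Nil_iff)
qed

lemma ddist_triangle:
  assumes "u \<in> verts G" "v \<in> verts G" "w \<in> verts G"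
  shows "ddist u w \<le> ddist u v + ddist v w"
proof -
  obtain p where p: "awalk u p v" "length p = ddist u v" using assms ddist_attained by blast
  obtain q where q: "awalk v q w" "length q = ddist v w" using assms ddist_attained by blast
  show ?thesis using ddist_le[OF awalk_appendI[OF p(1) q(1)]] p q by simp
qed

lemma ddist_arc_le_1:
  assumes "(u, v) \<in> arcs_ends G"
  shows "ddist u v \<le> 1"
proof -
  obtain e where "e \<in> arcs G" "tail G e = u" "head G e = v"
    using assms by (auto simp: arcs_ends_conv)
  then show ?thesis using ddist_le[of u "[e]" v] by (auto simp: awalk_simps)
qed

text \<open>Take the tail of the last arc of a shortest walk: the rest of the walk bounds its
  distance by \<open>n\<close> from above, the triangle inequality from below.\<close>

lemma ddist_SucE:
  assumes "u \<in> verts G" "v \<in> verts G" "ddist u v = Suc n"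
  obtains w where "w \<in> verts G" "ddist u w = n" "(w, v) \<in> arcs_ends G"
proof -
  obtain p where p: "awalk u p v" "length p = Suc n" using assms ddist_attained by metis
  then obtain q e where "p = q @ [e]" by (metis length_Suc_conv_rev)
  with p have q: "awalk u q (tail G e)" "length q = n" "e \<in> arcs G" "head G e = v"
    by (auto simp: awalk_Cons_iff awalk_Nil_iff)
  then have e: "(tail G e, v) \<in> arcs_ends G" by (auto simp: arcs_ends_conv)
  have w: "tail G e \<in> verts G" using q by simp
  have "Suc n \<le> ddist u (tail G e) + 1"
    using ddist_triangle[OF assms(1) w assms(2)] ddist_arc_le_1[OF e] assms(3) by simp
  then have "ddist u (tail G e) = n" using ddist_le[OF q(1)] q(2) by simp
  then show ?thesis using that w e by blast
qed

lemma ddist_eq_1_arc: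
  assumes "u \<in> verts G" "v \<in> verts G" "ddist u v = 1"
  shows "(u, v) \<in> arcs_ends G"
  using ddist_SucE[of u v 0] assms by (metis One_nat_def ddist_eq_0_iff)

lemma arcs_endsD:
  assumes "(u, v) \<in> arcs_ends G"
  shows "u \<in> verts G" "v \<in> verts G" "u \<noteq> v"
  using assms no_loops by (auto simp: arcs_ends_conv)

lemma inj_on_map_prod_arcs_ends:
  assumes "inj_on f (verts G)"
  shows "inj_on (map_prod f f) (arcs_ends G)"
proof (rule inj_on_subset)
  show "inj_on (map_prod f f) (verts G \<times> verts G)" using assms assms by (rule map_prod_inj_on)
  show "arcs_ends G \<subseteq> verts G \<times> verts G" using arcs_endsD by auto
qed

lemma ddist_eq_1_iff:
  assumes "u \<in> verts G" "v \<in> verts G"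
  shows "ddist u v = 1 \<longleftrightarrow> (u, v) \<in> arcs_ends G"
  using ddist_eq_1_arc[OF assms] ddist_arc_le_1[of u v] ddist_eq_0_iff[OF assms] arcs_endsD[of u v]
  by fastforce

text \<open>Stepping back from \<open>v\<close> along a geodesic lowers the distance from
  \<open>u\<close> by exactly 1 each time, so no value is skipped.\<close>

lemma ddist_intermediate:
  assumes "u \<in> verts G" "v \<in> verts G" "n \<le> ddist u v"
  shows "\<exists>w\<in>verts G. ddist u w = n"
  using assms(2,3)
proof (induction "ddist u v" arbitrary: v)
  case 0
  then show ?case by auto
next
  case (Suc m)
  show ?case
  proof (cases "n = Suc m")
    case True
    then show ?thesis using Suc by auto
  next
    case False
    obtain w where "w \<in> verts G" "ddist u w = m"
      using ddist_SucE[OF assms(1) Suc.prems(1) Suc.hyps(2)[symmetric]] .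
    then show ?thesis using Suc False by (metis le_Suc_eq)
  qed
qed

lemma finite_ddists: "finite {ddist u v | u v. u \<in> verts G \<and> v \<in> verts G}"
proof -
  have "{ddist u v | u v. u \<in> verts G \<and> v \<in> verts G} = case_prod ddist ` (verts G \<times> verts G)"
    by auto
  then show ?thesis by simp
qed

lemma ddist_le_diam:
  assumes "u \<in> verts G" "v \<in> verts G"
  shows "ddist u v \<le> diam"
  unfolding diam_def using assms by (intro Max_ge[OF finite_ddists]) blast

lemma diam_attained:
  obtains u v where "u \<in> verts G" "v \<in> verts G" "ddist u v = diam"
proof -
  have "diam \<in> {ddist u v | u v. u \<in> verts G \<and> v \<in> verts G}"
    unfolding diam_def using verts_nonempty by (intro Max_in[OF finite_ddists]) auto
  then show ?thesis using that by auto
qed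

text \<open>Distance 0 singles out each vertex. This is the witness that makes the
  \<open>LEAST\<close> in \<open>weak_dim\<close> attained.\<close>

lemma weakly_resolving_verts: "weakly_resolving (verts G)"
  unfolding weakly_resolving_def two_way_dist_def
  by simp (metis ddist_eq_0_iff)

lemma weak_dim_attained:
  obtains W where "weakly_resolving W" "card W = weak_dim"
proof -
  have "\<exists>m W. weakly_resolving W \<and> card W = m" using weakly_resolving_verts by blast
  then have "\<exists>W. weakly_resolving W \<and> card W = weak_dim" unfolding weak_dim_def by (rule LeastI_ex)
  then show ?thesis using that by blast
qed

lemma weak_dim_le: "weakly_resolving W \<Longrightarrow> weak_dim \<le> card W"
  unfolding weak_dim_def by (rule Least_le) blast

subsection \<open>The lower bound\<close>

text \<open>The first vertex of the geodesic tells the deleted ones apart, and each remaining vertex is told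
  apart from all others by its distance 0 to itself.\<close>

lemma weak_dim_add_diam_le: "weak_dim + diam \<le> card (verts G)"
proof -
  obtain x y where xy: "x \<in> verts G" "y \<in> verts G" "ddist x y = diam" by (rule diam_attained)
  \<comment> \<open>Only the distances from \<open>x\<close> matter, so the chosen vertices need not
    lie on one common geodesic. The index starts at 1 so that \<open>x\<close> itself survives in
    \<open>W\<close>.\<close>
  have "\<forall>i\<in>{1..diam}. \<exists>w\<in>verts G. ddist x w = i"
    using ddist_intermediate[OF xy(1,2)] xy(3) by auto
  then obtain p where p: "\<And>i. i \<in> {1..diam} \<Longrightarrow> p i \<in> verts G \<and> ddist x (p i) = i" by metis
  have inj: "inj_on p {1..diam}" using p by (metis inj_onI)
  have sub: "p ` {1..diam} \<subseteq> verts G" using p by blast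
  define W where "W = verts G - p ` {1..diam}"
  have x: "x \<in> W" using xy(1) p ddist_eq_0_iff[of x x] by (force simp: W_def)
  have "weakly_resolving W"
    unfolding weakly_resolving_def
  proof (intro conjI ballI impI)
    fix u v assume uv: "u \<in> verts G" "v \<in> verts G" "u \<noteq> v"
    show "\<exists>w\<in>W. two_way_dist w u \<noteq> two_way_dist w v"
    proof (cases "u \<in> W \<or> v \<in> W")
      case True
      then show ?thesis using uv unfolding two_way_dist_def by (metis ddist_eq_0_iff prod.inject)
    next
      case False
      then have "ddist x u \<noteq> ddist x v" using p uv by (auto simp: W_def)
      then show ?thesis using x by (auto simp: two_way_dist_def)
    qed
  qed (auto simp: W_def)
  then have "weak_dim \<le> card W" by (rule weak_dim_le)
  moreover have "card W = card (verts G) - diam"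
    unfolding W_def using sub inj by (simp add: card_Diff_subset finite_subset card_image)
  moreover have "diam \<le> card (verts G)"
    using card_mono[OF finite_verts sub] inj by (simp add: card_image)
  ultimately show ?thesis by simp
qed

section \<open>Arcs versus vertices, and the directed cycle\<close>

lemma ex_other_vertex:
  assumes "diam \<ge> 1" "u \<in> verts G"
  obtains v where "v \<in> verts G" "v \<noteq> u"
  using diam_attained assms by (metis ddist_eq_0_iff not_one_le_zero)

text \<open>Positive diameter gives a second vertex, and the first arc of a walk to it leaves
  \<open>u\<close>. So every out-degree is positive, which yields at least as many arcs as
  vertices.\<close>

lemma tail_image_arcs:
  assumes "diam \<ge> 1"
  shows "tail G ` arcs G = verts G"
proof
  show "verts G \<subseteq> tail G ` arcs G"
  proof
    fix u assume u: "u \<in> verts G"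
    then obtain v where v: "v \<in> verts G" "v \<noteq> u" using ex_other_vertex assms by blast
    then obtain p where p: "awalk u p v" using ex_awalk u by blast
    with v obtain e q where "p = e # q" by (cases p) (auto simp: awalk_Nil_iff)
    then show "u \<in> tail G ` arcs G" using p by (auto simp: awalk_Cons_iff)
  qed
qed auto

lemma head_image_arcs:
  assumes "diam \<ge> 1"
  shows "head G ` arcs G = verts G"
proof
  show "verts G \<subseteq> head G ` arcs G"
  proof
    fix u assume u: "u \<in> verts G"
    then obtain v where v: "v \<in> verts G" "v \<noteq> u" using ex_other_vertex assms by blast
    then obtain n where "ddist v u = Suc n" using ddist_eq_0_iff u by (cases "ddist v u") auto
    then obtain w where "(w, u) \<in> arcs_ends G" using ddist_SucE u v by metis
    then show "u \<in> head G ` arcs G" by (auto simp: arcs_ends_conv)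
  qed
qed auto

lemma card_verts_le_card_arcs:
  assumes "diam \<ge> 1"
  shows "card (verts G) \<le> card (arcs G)"
  using card_image_le[OF finite_arcs, of "tail G"] tail_image_arcs[OF assms] by simp

text \<open>When there are as many arcs as vertices, all in- and outdegrees are 1, so the distance from a
  fixed vertex is injective and numbers the vertices along the cycle.\<close>

lemma few_arcs_cycle:
  assumes k: "weak_dim \<ge> 1" and d: "diam \<ge> 1" and eq: "card (arcs G) = weak_dim + diam"
  shows "weak_dim = 1 \<and> digraph_iso G (with_proj (directed_cycle (diam + 1)))"
proof -
  \<comment> \<open>Both inequalities in \<open>weak_dim + diam\<close> <= |V| <= |A| become
    equalities.\<close>
  have n: "card (verts G) = card (arcs G)"
    using weak_dim_add_diam_le card_verts_le_card_arcs[OF d] eq by simp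
  \<comment> \<open>Both maps are onto the vertex set, which has as many elements as the arc set, so
    they are injective.\<close>
  have "inj_on (tail G) (arcs G)" "inj_on (head G) (arcs G)"
    using n tail_image_arcs[OF d] head_image_arcs[OF d] by (simp_all add: eq_card_imp_inj_on)
  then have out: "\<And>x y z. (x, y) \<in> arcs_ends G \<Longrightarrow> (x, z) \<in> arcs_ends G \<Longrightarrow> y = z"
    and inn: "\<And>x y z. (y, x) \<in> arcs_ends G \<Longrightarrow> (z, x) \<in> arcs_ends G \<Longrightarrow> y = z"
    by (auto simp: arcs_ends_conv dest: inj_onD)
  obtain v where v: "v \<in> verts G" using verts_nonempty by blast
  \<comment> \<open>By induction the predecessors at distance \<open>m\<close> coincide, and that
    vertex has only one out-neighbour.\<close>
  have "x = y" if "x \<in> verts G" "y \<in> verts G" "ddist v x = m" "ddist v y = m" for x y m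
    using that
  proof (induction m arbitrary: x y)
    case 0
    then show ?case using v ddist_eq_0_iff by metis
  next
    case (Suc m)
    obtain x' where "x' \<in> verts G" "ddist v x' = m" "(x', x) \<in> arcs_ends G"
      using ddist_SucE v Suc.prems by metis
    moreover obtain y' where "y' \<in> verts G" "ddist v y' = m" "(y', y) \<in> arcs_ends G"
      using ddist_SucE v Suc.prems by metis
    ultimately show ?case using Suc.IH out by metis
  qed
  then have inj: "inj_on (ddist v) (verts G)" by (metis inj_onI)
  then have "weakly_resolving {v}"
    using v unfolding weakly_resolving_def two_way_dist_def by (auto dest: inj_onD)
  then have k1: "weak_dim = 1" using weak_dim_le k by fastforce
  \<comment> \<open>There are now 1 + \<open>diam\<close> vertices with distinct distances of at
    most \<open>diam\<close>, so every value occurs.\<close>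
  have "ddist v ` verts G = {..<diam + 1}"
  proof (rule card_subset_eq)
    show "ddist v ` verts G \<subseteq> {..<diam + 1}" using ddist_le_diam v by (auto simp: less_Suc_eq_le)
    show "card (ddist v ` verts G) = card {..<diam + 1}" using inj n eq k1 by (simp add: card_image)
  qed simp
  then have bij: "bij_betw (ddist v) (verts G) {..<diam + 1}" using inj by (simp add: bij_betw_def)
  have arc: "ddist v y = Suc (ddist v x) mod (diam + 1)" if a: "(x, y) \<in> arcs_ends G" for x y
  proof -
    have xy: "x \<in> verts G" "y \<in> verts G" using arcs_endsD[OF a] by auto
    show ?thesis
    proof (cases "ddist v x < diam")
      case True
      \<comment> \<open>The vertex one step further has an in-neighbour at the same distance as
        \<open>x\<close>. By injectivity this is \<open>x\<close>, whose only out-neighbour is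
        \<open>y\<close>.\<close>
      then obtain z where z: "z \<in> verts G" "ddist v z = Suc (ddist v x)"
        using bij_betw_imp_surj_on[OF bij] by (metis Suc_eq_plus1 Suc_less_eq imageE lessThan_iff)
      then obtain w where "w \<in> verts G" "ddist v w = ddist v x" "(w, z) \<in> arcs_ends G"
        using ddist_SucE v by metis
      then have "z = y" using inj xy out a by (metis inj_onD)
      then show ?thesis using z True by simp
    next
      case False
      then have x: "ddist v x = diam" using ddist_le_diam[OF v xy(1)] by simp
      \<comment> \<open>Otherwise the predecessor of \<open>y\<close> on a geodesic from
        \<open>v\<close> is its only in-neighbour \<open>x\<close>, which puts \<open>y\<close> at
        distance \<open>diam\<close> + 1.\<close>
      have "ddist v y = 0"
      proof (rule ccontr)
        assume "ddist v y \<noteq> 0"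
        then obtain m where m: "ddist v y = Suc m" by (cases "ddist v y") auto
        then obtain w where "ddist v w = m" "(w, y) \<in> arcs_ends G" using ddist_SucE v xy by metis
        then have "ddist v x = m" using inn a by metis
        then show False using m x ddist_le_diam[OF v xy(2)] by simp
      qed
      then show ?thesis using x by simp
    qed
  qed
  have injp: "inj_on (map_prod (ddist v) (ddist v)) (arcs_ends G)"
    using inj by (rule inj_on_map_prod_arcs_ends)
  have "(ddist v x, ddist v y) \<in> parcs (directed_cycle (diam + 1))" if a: "(x, y) \<in> arcs_ends G" for x y
  proof -
    have "ddist v x < diam + 1" using ddist_le_diam[OF v arcs_endsD(1)[OF a]] by simp
    then show ?thesis using arc[OF a] by (auto simp: directed_cycle_def)
  qed
  then have sub: "map_prod (ddist v) (ddist v) ` arcs_ends G \<subseteq> parcs (directed_cycle (diam + 1))"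
    by auto
  have "finite (parcs (directed_cycle (diam + 1)))"
    using card_parcs_directed_cycle[of "diam + 1"] by (intro card_ge_0_finite) simp
  then have "map_prod (ddist v) (ddist v) ` arcs_ends G = parcs (directed_cycle (diam + 1))"
    using sub by (rule card_subset_eq)
      (simp add: card_image[OF injp] card_arcs_ends card_parcs_directed_cycle eq k1)
  moreover have "bij_betw (ddist v) (verts G) (pverts (directed_cycle (diam + 1)))"
    using bij by (simp add: directed_cycle_def)
  ultimately show ?thesis using k1 digraph_iso_pairI by blast
qed

end

subsection \<open>Counting the arcs of the extremal digraph\<close>

text \<open>Passing from d to d + 1 adds the full row x = d + 1 and the single pair (d, d + 1). The
  equation is doubled and shifted by 2 to avoid division and subtraction on naturals.\<close>

lemma card_step_pairs:
  assumes "d \<ge> 1"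
  shows "2 * card {(x, y). x \<in> {1..d} \<and> y \<in> {1..d} \<and> y \<le> Suc x} + 2 = d\<^sup>2 + 3 * d"
    (is "2 * card (?S d) + 2 = _")
  using assms
proof (induction d rule: nat_induct_at_least)
  case base
  have "?S 1 = {(1, 1)}" by auto
  then show ?case by (simp add: power2_eq_square)
next
  case (Suc d)
  have eq: "?S (Suc d) = ?S d \<union> ((\<lambda>y. (Suc d, y)) ` {1..Suc d} \<union> {(d, Suc d)})"
    using Suc.hyps by auto
  have fin: "finite (?S d)" by (rule finite_subset[of _ "{1..d} \<times> {1..d}"]) auto
  have "card (?S (Suc d)) = card (?S d) + card ((\<lambda>y. (Suc d, y)) ` {1..Suc d} \<union> {(d, Suc d)})"
    unfolding eq by (rule card_Un_disjoint) (use fin in auto)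
  also have "card ((\<lambda>y. (Suc d, y)) ` {1..Suc d} \<union> {(d, Suc d)}) = Suc d + 1"
    by (subst card_Un_disjoint) (auto simp: card_image inj_on_def)
  finally show ?case using Suc.IH by (simp add: power2_eq_square)
qed

lemma card_step_pairs_converse:
  "card {(x, y). x \<in> {1..d} \<and> y \<in> {1..d} \<and> x \<le> Suc y}
    = card {(x, y). x \<in> {1..d} \<and> y \<in> {1..d} \<and> y \<le> Suc (x::nat)}"
proof -
  have "{(x, y). x \<in> {1..d} \<and> y \<in> {1..d} \<and> x \<le> Suc y}
    = prod.swap ` {(x, y). x \<in> {1..d} \<and> y \<in> {1..d} \<and> y \<le> Suc x}"
    by (auto simp: image_iff)
  then show ?thesis by (simp only: card_image inj_swap)
qed

text \<open>A pair of functions is a function into pairs, and a coordinatewise condition then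
  describes a product set.\<close>

lemma card_PiE_pairs:
  assumes "finite I" and sub: "\<And>j. j \<in> I \<Longrightarrow> S j \<subseteq> D \<times> D"
  shows "card {(a, b). a \<in> I \<rightarrow>\<^sub>E D \<and> b \<in> I \<rightarrow>\<^sub>E D \<and> (\<forall>j\<in>I. (a j, b j) \<in> S j)}
    = (\<Prod>j\<in>I. card (S j))" (is "card ?Q = _")
proof -
  have "bij_betw (\<lambda>(a, b). \<lambda>j\<in>I. (a j, b j)) ?Q (PiE I S)"
  proof (rule bij_betw_byWitness[where f' = "\<lambda>f. (\<lambda>j\<in>I. fst (f j), \<lambda>j\<in>I. snd (f j))"])
    show "(\<lambda>f. (\<lambda>j\<in>I. fst (f j), \<lambda>j\<in>I. snd (f j))) ` PiE I S \<subseteq> ?Q"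
    proof (rule image_subsetI)
      fix f assume "f \<in> PiE I S"
      then have f: "f j \<in> S j" if "j \<in> I" for j using that by auto
      then have "fst (f j) \<in> D" "snd (f j) \<in> D" if "j \<in> I" for j
        using that sub by (force simp: mem_Times_iff)+
      then show "(\<lambda>j\<in>I. fst (f j), \<lambda>j\<in>I. snd (f j)) \<in> ?Q" using f by simp
    qed
  qed (auto simp: fun_eq_iff PiE_def extensional_def)
  then have "card ?Q = card (PiE I S)" by (rule bij_betw_same_card)
  then show ?thesis using assms(1) by (simp add: card_PiE)
qed

section \<open>Tuples and the arcs between them\<close>

lemma ball_double_iff:
  "(\<forall>j\<in>{1..2 * k}. P j) \<longleftrightarrow> (\<forall>r\<in>{1..k}. P (2 * r - 1) \<and> P (2 * r))" for k :: nat
proof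
  assume *: "\<forall>r\<in>{1..k}. P (2 * r - 1) \<and> P (2 * r)"
  show "\<forall>j\<in>{1..2 * k}. P j"
  proof
    fix j assume j: "j \<in> {1..2 * k}"
    show "P j"
    proof (cases "even j")
      case True
      then obtain r where "j = 2 * r" by (elim evenE)
      then show ?thesis using * j by auto
    next
      case False
      then obtain r where r: "j = 2 * r + 1" by (elim oddE)
      then have "P (2 * (r + 1) - 1)" using * j by (auto simp del: mult_Suc_right)
      then show ?thesis using r by simp
    qed
  qed
next
  assume *: "\<forall>j\<in>{1..2 * k}. P j"
  show "\<forall>r\<in>{1..k}. P (2 * r - 1) \<and> P (2 * r)"
  proof
    fix r assume "r \<in> {1..k}"
    then have "2 * r - 1 \<in> {1..2 * k}" "2 * r \<in> {1..2 * k}" by auto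
    then show "P (2 * r - 1) \<and> P (2 * r)" using * by blast
  qed
qed

lemma finite_tuples: "finite (tuples k d)"
  unfolding tuples_def by (intro finite_PiE) auto

lemma card_tuples: "card (tuples k d) = d ^ (2 * k)"
  unfolding tuples_def by (simp add: card_PiE)

text \<open>This counts the arcs of type (F1) or (F2) at one \<open>U i\<close>: one factor of the
  product shrinks to a singleton, the other 2k - 1 stay free.\<close>

lemma card_tuples_fixed:
  assumes "d \<ge> 1" "j \<in> {1..2 * k}"
  shows "card {a \<in> tuples k d. a j = 1} = d ^ (2 * k - 1)"
proof -
  have "{a \<in> tuples k d. a j = 1} = PiE {1..2 * k} (\<lambda>i. if i = j then {1} else {1..d})"
  proof (intro equalityI subsetI)
    fix a assume "a \<in> PiE {1..2 * k} (\<lambda>i. if i = j then {1} else {1..d})"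
    then have ext: "a \<in> extensional {1..2 * k}"
      and *: "\<And>i. i \<in> {1..2 * k} \<Longrightarrow> a i \<in> (if i = j then {1} else {1..d})"
      by (simp_all only: PiE_iff)
    have "a i \<in> {1..d}" if "i \<in> {1..2 * k}" for i
      using *[OF that] assms(1) by (auto split: if_splits)
    then show "a \<in> {a \<in> tuples k d. a j = 1}"
      using *[OF assms(2)] ext by (auto simp: tuples_def PiE_iff)
  qed (auto simp: tuples_def PiE_iff)
  then have "card {a \<in> tuples k d. a j = 1}
      = (\<Prod>i\<in>{1..2 * k}. card (if i = j then {1} else {1..d}))"
    by (simp add: card_PiE)
  also have "\<dots> = (\<Prod>i\<in>{1..2 * k} - {j}. card (if i = j then {1} else {1..d}))"
    using assms(2) by (subst prod.remove[of _ j]) auto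
  also have "\<dots> = (\<Prod>i\<in>{1..2 * k} - {j}. d)" by (intro prod.cong) auto
  finally show ?thesis using assms(2) by simp
qed

text \<open>Apart from \<open>a \<noteq> b\<close>, condition (F3) is coordinatewise, so the pairs
  satisfying it number \<open>m ^ (2 * k)\<close>. The diagonal satisfies it too and is
  subtracted.\<close>

lemma card_tuple_arcs:
  assumes "d \<ge> 1"
  shows "real (card {(a, b). a \<in> tuples k d \<and> b \<in> tuples k d \<and> a \<noteq> b \<and>
      (\<forall>r\<in>{1..k}. int (a (2 * r - 1)) - int (b (2 * r - 1)) \<ge> -1 \<and>
                  int (a (2 * r)) - int (b (2 * r)) \<le> 1)})
    = ((real d ^ 2 + 3 * real d - 2) / 2) ^ (2 * k) - real d ^ (2 * k)" (is "real (card ?C) = _")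
proof -
  \<comment> \<open>Along an arc, a distance from a fixed vertex (odd coordinate) rises by at most 1
    and a distance to it (even coordinate) drops by at most 1. The two relations are converse, hence
    equally large.\<close>
  define S where "S j = (if odd j
      then {(x, y). x \<in> {1..d} \<and> y \<in> {1..d} \<and> y \<le> Suc x}
      else {(x, y). x \<in> {1..d} \<and> y \<in> {1..d} \<and> x \<le> Suc y})" for j :: nat
  define m where "m = card {(x, y). x \<in> {1..d} \<and> y \<in> {1..d} \<and> y \<le> Suc x}"
  have cardS: "card (S j) = m" for j using card_step_pairs_converse[of d] unfolding S_def m_def by (cases "odd j") simp_all
  let ?Q = "{(a, b). a \<in> tuples k d \<and> b \<in> tuples k d \<and> (\<forall>j\<in>{1..2 * k}. (a j, b j) \<in> S j)}"
  let ?I = "(\<lambda>a. (a, a)) ` tuples k d"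
  have Q: "card ?Q = m ^ (2 * k)"
    unfolding tuples_def by (subst card_PiE_pairs) (auto simp: cardS, auto simp: S_def split: if_splits)
  have mem: "a j \<in> {1..d}" if "a \<in> tuples k d" "j \<in> {1..2 * k}" for a j
    using that by (auto simp: tuples_def)
  have "?Q = ?C \<union> ?I"
  proof -
    have step: "(\<forall>j\<in>{1..2 * k}. (a j, b j) \<in> S j) \<longleftrightarrow>
      (\<forall>r\<in>{1..k}. int (a (2 * r - 1)) - int (b (2 * r - 1)) \<ge> -1 \<and>
                  int (a (2 * r)) - int (b (2 * r)) \<le> 1)"
      if "a \<in> tuples k d" "b \<in> tuples k d" for a b
      unfolding ball_double_iff
    proof (rule ball_cong[OF refl])
      fix r assume r: "r \<in> {1..k}"
      then have "odd (2 * r - 1)" "2 * r - 1 \<in> {1..2 * k}" "2 * r \<in> {1..2 * k}" by auto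
      then show "(a (2 * r - 1), b (2 * r - 1)) \<in> S (2 * r - 1) \<and> (a (2 * r), b (2 * r)) \<in> S (2 * r) \<longleftrightarrow>
        int (a (2 * r - 1)) - int (b (2 * r - 1)) \<ge> -1 \<and> int (a (2 * r)) - int (b (2 * r)) \<le> 1"
        using mem[OF that(1)] mem[OF that(2)] by (simp add: S_def) linarith
    qed
    then have "?Q = {(a, b). a \<in> tuples k d \<and> b \<in> tuples k d \<and>
      (\<forall>r\<in>{1..k}. int (a (2 * r - 1)) - int (b (2 * r - 1)) \<ge> -1 \<and>
                  int (a (2 * r)) - int (b (2 * r)) \<le> 1)}" by blast
    then show ?thesis by auto
  qed
  moreover have "finite ?C"
    by (rule finite_subset[of _ "tuples k d \<times> tuples k d"]) (auto simp: finite_tuples)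
  ultimately have "m ^ (2 * k) = card ?C + card ?I"
    unfolding Q[symmetric] by (simp only:) (rule card_Un_disjoint, auto simp: finite_tuples)
  also have "card ?I = d ^ (2 * k)" by (simp add: card_image inj_on_def card_tuples)
  finally have "real m ^ (2 * k) = real (card ?C) + real d ^ (2 * k)"
    by (simp flip: of_nat_add of_nat_power)
  moreover have "real m = (real d ^ 2 + 3 * real d - 2) / 2"
  proof -
    have "real (2 * m + 2) = real (d\<^sup>2 + 3 * d)"
      unfolding m_def card_step_pairs[OF assms] ..
    then show ?thesis by simp
  qed
  ultimately show ?thesis by simp
qed

section \<open>The extremal digraph\<close>

lemma finite_pverts_Gamma: "finite (pverts (Gamma_digraph k d))"
  by (simp add: Gamma_digraph_def finite_tuples)

lemma parcs_Gamma_bar_subset: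
  "parcs (Gamma_bar_digraph k d) \<subseteq> pverts (Gamma_bar_digraph k d) \<times> pverts (Gamma_bar_digraph k d)"
  by (auto simp: Gamma_bar_digraph_def Gamma_digraph_def)

lemma finite_parcs_Gamma_bar: "finite (parcs (Gamma_bar_digraph k d))"
  by (rule finite_subset[OF parcs_Gamma_bar_subset])
    (simp add: Gamma_bar_digraph_def finite_pverts_Gamma)

lemma card_offdiag:
  assumes "finite A"
  shows "card {(x, y). x \<in> A \<and> y \<in> A \<and> x \<noteq> y} = card A * card A - card A"
proof -
  have "{(x, y). x \<in> A \<and> y \<in> A \<and> x \<noteq> y} = A \<times> A - (\<lambda>x. (x, x)) ` A" by auto
  moreover have "card (A \<times> A - (\<lambda>x. (x, x)) ` A) = card (A \<times> A) - card ((\<lambda>x. (x, x)) ` A)"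
    using assms by (intro card_Diff_subset) auto
  ultimately show ?thesis by (simp add: card_image inj_on_def card_cartesian_product)
qed

text \<open>(F1) and (F2) give k d^(2k-1) arcs each. The diagonal removed from (F3) costs d^(2k) = d
  d^(2k-1), whence the factor 2k - d. The arcs among the \<open>U i\<close> give k^2 - k.\<close>

lemma card_parcs_Gamma_bar:
  assumes "d \<ge> 1" "k \<ge> 1"
  shows "real (card (parcs (Gamma_bar_digraph k d))) = ((real d ^ 2 + 3 * real d - 2) / 2) ^ (2 * k)
        + (2 * real k - real d) * real d ^ (2 * k - 1) + real k ^ 2 - real k"
proof -
  define R where "R = {(a, b). a \<in> tuples k d \<and> b \<in> tuples k d \<and> a \<noteq> b \<and>
      (\<forall>r\<in>{1..k}. int (a (2 * r - 1)) - int (b (2 * r - 1)) \<ge> -1 \<and>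
                  int (a (2 * r)) - int (b (2 * r)) \<le> 1)}"
  define A where "A = (\<lambda>(i, a). (U i, Tup a)) ` (SIGMA i:{1..k}. {a \<in> tuples k d. a (2 * i - 1) = 1})"
  define B where "B = (\<lambda>(i, a). (Tup a, U i)) ` (SIGMA i:{1..k}. {a \<in> tuples k d. a (2 * i) = 1})"
  define C where "C = map_prod Tup Tup ` R"
  define D where "D = map_prod U U ` {(i, j). i \<in> {1..k} \<and> j \<in> {1..k} \<and> i \<noteq> j}"
  have parcs: "parcs (Gamma_bar_digraph k d) = A \<union> B \<union> C \<union> D"
    unfolding Gamma_bar_digraph_def Gamma_digraph_def A_def B_def C_def D_def R_def
    by (auto simp: image_iff)
  then have fin: "finite A" "finite B" "finite C" "finite D"
    using finite_parcs_Gamma_bar[of k d] by auto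
  have "card A = card (SIGMA i:{1..k}. {a \<in> tuples k d. a (2 * i - 1) = 1})"
    unfolding A_def by (rule card_image) (auto simp: inj_on_def)
  also have "\<dots> = (\<Sum>i\<in>{1..k}. card {a \<in> tuples k d. a (2 * i - 1) = 1})"
    using finite_tuples by (intro card_SigmaI) auto
  also have "\<dots> = (\<Sum>i\<in>{1..k}. d ^ (2 * k - 1))"
    using assms(1) by (intro sum.cong refl card_tuples_fixed) auto
  finally have A: "card A = k * d ^ (2 * k - 1)" by simp
  have "card B = card (SIGMA i:{1..k}. {a \<in> tuples k d. a (2 * i) = 1})"
    unfolding B_def by (rule card_image) (auto simp: inj_on_def)
  also have "\<dots> = (\<Sum>i\<in>{1..k}. card {a \<in> tuples k d. a (2 * i) = 1})"
    using finite_tuples by (intro card_SigmaI) auto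
  also have "\<dots> = (\<Sum>i\<in>{1..k}. d ^ (2 * k - 1))"
    using assms(1) by (intro sum.cong refl card_tuples_fixed) auto
  finally have B: "card B = k * d ^ (2 * k - 1)" by simp
  have "card C = card R"
    unfolding C_def by (rule card_image) (auto simp: inj_on_def)
  then have C: "real (card C) = ((real d ^ 2 + 3 * real d - 2) / 2) ^ (2 * k) - real d ^ (2 * k)"
    using card_tuple_arcs[OF assms(1)] by (simp add: R_def)
  have "card D = card {(i, j). i \<in> {1..k} \<and> j \<in> {1..k} \<and> i \<noteq> j}"
    unfolding D_def by (rule card_image) (auto simp: inj_on_def)
  then have "card D = k * k - k" by (simp only: card_offdiag finite_atLeastAtMost card_atLeastAtMost) simp
  then have D: "real (card D) = real k ^ 2 - real k"
    using assms(2) by (simp add: of_nat_diff power2_eq_square)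
  have disj: "A \<inter> B = {}" "(A \<union> B) \<inter> C = {}" "(A \<union> B \<union> C) \<inter> D = {}"
    by (auto simp: A_def B_def C_def D_def)
  have "card (parcs (Gamma_bar_digraph k d)) = card A + card B + card C + card D"
    unfolding parcs using fin disj by (simp add: card_Un_disjoint)
  moreover have "real d ^ (2 * k) = real d * real d ^ (2 * k - 1)"
    using assms(2) by (simp flip: power_Suc)
  ultimately show ?thesis using A B C D by (simp add: algebra_simps)
qed

text \<open>No vertex is isolated, so an embedding that hits all arcs also hits all
  vertices.\<close>

lemma Gamma_bar_vertex_on_arc:
  assumes "k \<ge> 1" "d \<ge> 1" "v \<in> pverts (Gamma_bar_digraph k d)"
  shows "\<exists>u. (u, v) \<in> parcs (Gamma_bar_digraph k d) \<or> (v, u) \<in> parcs (Gamma_bar_digraph k d)"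
proof (cases v)
  case (U i)
  define a where "a = (\<lambda>j\<in>{1..2 * k}. 1::nat)"
  have "(U i, Tup a) \<in> parcs (Gamma_bar_digraph k d)"
    using assms U by (auto simp: a_def tuples_def Gamma_bar_digraph_def Gamma_digraph_def)
  then show ?thesis using U by blast
next
  case (Tup a)
  then have a: "a \<in> tuples k d" using assms by (auto simp: Gamma_bar_digraph_def Gamma_digraph_def)
  \<comment> \<open>Minimal odd and maximal even coordinates make \<open>b\<close> an out-neighbour
    of every other tuple; \<open>b\<close> itself is reached from \<open>U 1\<close>.\<close>
  define b where "b = (\<lambda>j\<in>{1..2 * k}. if odd j then 1 else d)"
  have b: "b \<in> tuples k d" using assms by (auto simp: b_def tuples_def)
  show ?thesis
  proof (cases "a = b")
    case True
    then have "(U 1, Tup a) \<in> parcs (Gamma_bar_digraph k d)"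
      using assms a by (auto simp: Gamma_bar_digraph_def Gamma_digraph_def b_def)
    then show ?thesis using Tup by blast
  next
    case False
    have "int (a (2 * r - 1)) - int (b (2 * r - 1)) \<ge> -1 \<and> int (a (2 * r)) - int (b (2 * r)) \<le> 1"
      if r: "r \<in> {1..k}" for r
    proof -
      have "2 * r \<in> {1..2 * k}" using r by auto
      then have "a (2 * r) \<le> d" using a unfolding tuples_def by (auto dest: PiE_mem)
      moreover have "b (2 * r - 1) = 1" "b (2 * r) = d" using r by (auto simp: b_def)
      ultimately show ?thesis by simp
    qed
    then have "(Tup a, Tup b) \<in> parcs (Gamma_bar_digraph k d)"
      using False a b by (simp add: Gamma_bar_digraph_def Gamma_digraph_def)
    then show ?thesis using Tup by blast
  qed
qed

subsection \<open>The upper bound\<close>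

context strong_digraph
begin

text \<open>The arc extends a geodesic ending in \<open>x\<close> or one starting in
  \<open>y\<close>. This is the source of (F3).\<close>

lemma arcs_ends_dist_le:
  assumes "(x, y) \<in> arcs_ends G" "w \<in> verts G"
  shows "ddist w y \<le> ddist w x + 1" "ddist x w \<le> ddist y w + 1"
  using assms arcs_endsD[OF assms(1)] ddist_arc_le_1[OF assms(1)]
    ddist_triangle[of w x y] ddist_triangle[of x y w] by auto

text \<open>The clauses on \<open>w\<close> and on odd coordinates let distances be read off
  \<open>f\<close>, as needed to exclude k >= 2 with d >= 3.\<close>

lemma ex_Gamma_bar_embedding:
  obtains f w where
    "inj_on f (verts G)"
    "map_prod f f ` arcs_ends G \<subseteq> parcs (Gamma_bar_digraph weak_dim diam)"
    "\<And>i. i \<in> {1..weak_dim} \<Longrightarrow> w i \<in> verts G \<and> f (w i) = U i"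
    "\<And>x a i. x \<in> verts G \<Longrightarrow> f x = Tup a \<Longrightarrow> i \<in> {1..weak_dim} \<Longrightarrow> a (2 * i - 1) = ddist (w i) x"
    "f ` verts G \<subseteq> pverts (Gamma_bar_digraph weak_dim diam)"
proof -
  define k where "k = weak_dim"
  obtain W where W: "weakly_resolving W" "card W = k" unfolding k_def by (rule weak_dim_attained)
  then have "finite W" and WV: "W \<subseteq> verts G" by (auto simp: weakly_resolving_def)
  then obtain w where w: "bij_betw w {1..k} W"
    using W(2) by (metis ex_bij_betw_nat_finite_1)
  then have wW: "w i \<in> W" if "i \<in> {1..k}" for i using that by (auto simp: bij_betw_def)
  define t where "t x = (\<lambda>j\<in>{1..2 * k}. if odd j then ddist (w ((j + 1) div 2)) x
      else ddist x (w (j div 2)))" for x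
  have t: "t x (2 * i - 1) = ddist (w i) x" "t x (2 * i) = ddist x (w i)" if "i \<in> {1..k}" for x i
    using that by (auto simp: t_def)
  define f where "f x = (if x \<in> W then U (the_inv_into {1..k} w x) else Tup (t x))" for x
  have fw: "f (w i) = U i" if "i \<in> {1..k}" for i
    using that wW w by (auto simp: f_def bij_betw_def the_inv_into_f_f)
  have fW: "\<exists>i\<in>{1..k}. x = w i \<and> f x = U i" if "x \<in> W" for x
    using that bij_betw_imp_surj_on[OF w] fw by blast
  have ft: "f x = Tup (t x)" if "x \<notin> W" for x using that by (simp add: f_def)
  \<comment> \<open>Entries are positive because \<open>x\<close> differs from every
    \<open>w r\<close>. A vertex of \<open>W\<close> would have an entry 0, so it is sent to some
    \<open>U i\<close> instead.\<close>
  have tt: "t x \<in> tuples k diam" if "x \<in> verts G" "x \<notin> W" for x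
  proof -
    have "t x j \<in> {1..diam}" if "j \<in> {1..2 * k}" for j
    proof -
      have "\<forall>j\<in>{1..2 * k}. t x j \<in> {1..diam}"
        unfolding ball_double_iff
      proof
        fix r assume r: "r \<in> {1..k}"
        then have "w r \<in> verts G" "w r \<noteq> x" using wW WV \<open>x \<notin> W\<close> by auto
        then have "ddist (w r) x \<noteq> 0" "ddist x (w r) \<noteq> 0"
          using ddist_eq_0_iff \<open>x \<in> verts G\<close> by auto
        then show "t x (2 * r - 1) \<in> {1..diam} \<and> t x (2 * r) \<in> {1..diam}"
          using t[OF r] ddist_le_diam \<open>w r \<in> verts G\<close> \<open>x \<in> verts G\<close> by simp
      qed
      then show ?thesis using that by blast
    qed
    then show ?thesis by (auto simp: tuples_def t_def)
  qed
  \<comment> \<open>Equal tuples would mean equal distances to and from all of \<open>W\<close>,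
    against its being resolving.\<close>
  have inj: "inj_on f (verts G)"
  proof (rule inj_onI, rule ccontr)
    fix x y assume xy: "x \<in> verts G" "y \<in> verts G" "f x = f y" "x \<noteq> y"
    then have "x \<notin> W" "y \<notin> W" using fW ft by (metis gamma_vertex.distinct(1) gamma_vertex.inject(1))+
    then have "t x = t y" using xy(3) by (simp add: ft)
    moreover obtain u where u: "u \<in> W" "two_way_dist u x \<noteq> two_way_dist u y"
      using W(1) xy unfolding weakly_resolving_def by blast
    moreover obtain i where i: "i \<in> {1..k}" "u = w i" using fW[OF u(1)] by blast
    ultimately show False using t[OF i(1), of x] t[OF i(1), of y] by (simp add: two_way_dist_def)
  qed
  have "(f x, f y) \<in> parcs (Gamma_bar_digraph k diam)" if a: "(x, y) \<in> arcs_ends G" for x y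
  proof -
    note xy = arcs_endsD[OF a]
    have one: "ddist x y = 1" using ddist_eq_1_iff a xy by simp
    consider "x \<in> W" "y \<in> W" | "x \<in> W" "y \<notin> W" | "x \<notin> W" "y \<in> W" | "x \<notin> W" "y \<notin> W" by blast
    then show ?thesis
    proof cases
      case 1
      then obtain i j where "i \<in> {1..k}" "j \<in> {1..k}" "x = w i" "y = w j" "f x = U i" "f y = U j"
        using fW by metis
      then show ?thesis using xy by (auto simp: Gamma_bar_digraph_def)
    next
      case 2
      then obtain i where i: "i \<in> {1..k}" "x = w i" "f x = U i" using fW by metis
      then show ?thesis using 2 t[OF i(1)] one tt[OF xy(2) 2(2)] ft[OF 2(2)]
        by (auto simp: Gamma_bar_digraph_def Gamma_digraph_def)
    next
      case 3
      then obtain i where i: "i \<in> {1..k}" "y = w i" "f y = U i" using fW by metis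
      then show ?thesis using 3 t[OF i(1)] one tt[OF xy(1) 3(1)] ft[OF 3(1)]
        by (auto simp: Gamma_bar_digraph_def Gamma_digraph_def)
    next
      case 4
      have "f x \<noteq> f y" using inj xy by (metis inj_onD)
      then have ne: "t x \<noteq> t y" using ft 4 by metis
      have "int (t x (2 * r - 1)) - int (t y (2 * r - 1)) \<ge> -1 \<and> int (t x (2 * r)) - int (t y (2 * r)) \<le> 1"
        if r: "r \<in> {1..k}" for r
      proof -
        have "w r \<in> verts G" using wW WV r by auto
        from arcs_ends_dist_le[OF a this] show ?thesis unfolding t[OF r] by linarith
      qed
      then show ?thesis using 4 ne tt xy ft
        by (simp add: Gamma_bar_digraph_def Gamma_digraph_def)
    qed
  qed
  then have sub: "map_prod f f ` arcs_ends G \<subseteq> parcs (Gamma_bar_digraph k diam)" by auto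
  have "f ` verts G \<subseteq> pverts (Gamma_bar_digraph k diam)"
  proof safe
    fix x assume "x \<in> verts G"
    then show "f x \<in> pverts (Gamma_bar_digraph k diam)"
      using fW[of x] tt[of x] ft[of x] by (cases "x \<in> W") (auto simp: Gamma_bar_digraph_def Gamma_digraph_def)
  qed
  moreover have "a (2 * i - 1) = ddist (w i) x" if "x \<in> verts G" "f x = Tup a" "i \<in> {1..k}" for x a i
    using that fW[of x] ft[of x] t[of i x] by (cases "x \<in> W") auto
  moreover have "w i \<in> verts G \<and> f (w i) = U i" if "i \<in> {1..k}" for i
    using that wW WV fw by auto
  ultimately show ?thesis using that[of f w] inj sub unfolding k_def by blast
qed

lemma card_arcs_le_Gamma_bar: "card (arcs G) \<le> card (parcs (Gamma_bar_digraph weak_dim diam))"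
proof -
  obtain f where f: "inj_on f (verts G)"
    "map_prod f f ` arcs_ends G \<subseteq> parcs (Gamma_bar_digraph weak_dim diam)"
    by (rule ex_Gamma_bar_embedding) blast
  have "card (arcs G) = card (map_prod f f ` arcs_ends G)"
    using card_image[OF inj_on_map_prod_arcs_ends[OF f(1)]] card_arcs_ends by simp
  then show ?thesis using card_mono[OF finite_parcs_Gamma_bar f(2)] by simp
qed

section \<open>Equality in the upper bound\<close>

text \<open>With equal finite cardinalities the injective arc map is onto, so every arc and every
  tuple of the extremal digraph must be realised in \<open>G\<close>.\<close>

lemma card_arcs_eq_Gamma_barD:
  assumes k: "weak_dim \<ge> 1" and d: "diam \<ge> 1"
    and eq: "card (arcs G) = card (parcs (Gamma_bar_digraph weak_dim diam))"
  shows "digraph_iso G (with_proj (Gamma_bar_digraph weak_dim diam))"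
    and "card (verts G) = card (pverts (Gamma_bar_digraph weak_dim diam))"
    and "weak_dim = 1 \<or> diam \<le> 2"
proof -
  let ?H = "Gamma_bar_digraph weak_dim diam"
  obtain f w where inj: "inj_on f (verts G)" and sub: "map_prod f f ` arcs_ends G \<subseteq> parcs ?H"
    and w: "\<And>i. i \<in> {1..weak_dim} \<Longrightarrow> w i \<in> verts G \<and> f (w i) = U i"
    and tup: "\<And>x a i. x \<in> verts G \<Longrightarrow> f x = Tup a \<Longrightarrow> i \<in> {1..weak_dim} \<Longrightarrow> a (2 * i - 1) = ddist (w i) x"
    and pv: "f ` verts G \<subseteq> pverts ?H"
    by (rule ex_Gamma_bar_embedding) (rule that)
  have arcs: "map_prod f f ` arcs_ends G = parcs ?H"
    using card_image[OF inj_on_map_prod_arcs_ends[OF inj]] card_arcs_ends eq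
    by (intro card_subset_eq[OF finite_parcs_Gamma_bar sub]) simp
  have "pverts ?H \<subseteq> f ` verts G"
  proof
    fix v assume "v \<in> pverts ?H"
    then obtain u where "(u, v) \<in> parcs ?H \<or> (v, u) \<in> parcs ?H"
      using Gamma_bar_vertex_on_arc k d by blast
    then show "v \<in> f ` verts G" unfolding arcs[symmetric] using arcs_endsD by auto
  qed
  with pv have img: "f ` verts G = pverts ?H" by blast
  then have bij: "bij_betw f (verts G) (pverts ?H)" using inj by (simp add: bij_betw_def)
  then show "digraph_iso G (with_proj ?H)" using arcs by (rule digraph_iso_pairI)
  show "card (verts G) = card (pverts ?H)" using bij by (rule bij_betw_same_card)
  show "weak_dim = 1 \<or> diam \<le> 2"
  proof (rule ccontr)
    assume "\<not> ?thesis"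
    with k have big: "weak_dim \<ge> 2" "diam \<ge> 3" by auto
    \<comment> \<open>Coordinates 1 and 3 are the distances from \<open>w 1\<close> and
      \<open>w 2\<close>. The entry 3 requires d >= 3, and its index requires k >= 2.\<close>
    define a where "a = (\<lambda>j\<in>{1..2 * weak_dim}. if j = 3 then 3 else 1::nat)"
    have a: "a \<in> tuples weak_dim diam" using big by (auto simp: a_def tuples_def)
    then have "Tup a \<in> f ` verts G" unfolding img by (simp add: Gamma_bar_digraph_def Gamma_digraph_def)
    then obtain x where x: "x \<in> verts G" "f x = Tup a" by auto
    have "ddist (w 1) x = 1" "ddist (w 2) x = 3"
      using tup[OF x, of 1] tup[OF x, of 2] big by (auto simp: a_def)
    \<comment> \<open>The arc from \<open>U 2\<close> to \<open>U 1\<close> pulls back to one from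
      \<open>w 2\<close> to \<open>w 1\<close>, so \<open>ddist (w 2) x\<close> would be at most 1 +
      1.\<close>
    moreover have "ddist (w 2) (w 1) \<le> 1"
    proof -
      have "(U 2, U 1) \<in> map_prod f f ` arcs_ends G"
        unfolding arcs using big by (auto simp: Gamma_bar_digraph_def)
      then obtain u v where uv: "(u, v) \<in> arcs_ends G" "f u = U 2" "f v = U 1" by auto
      then have "u = w 2" "v = w 1" using w[of 1] w[of 2] big arcs_endsD[OF uv(1)] inj
        by (auto intro: inj_onD[OF inj])
      then show ?thesis using ddist_arc_le_1 uv by blast
    qed
    ultimately show False using ddist_triangle[of "w 2" "w 1" x] w[of 1] w[of 2] x big by auto
  qed
qed

lemma diam_1_complete:
  assumes "diam = 1" "card (verts G) = n"
  shows "digraph_iso G (with_proj (standard_complete n))"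
proof -
  have arc: "(x, y) \<in> arcs_ends G \<longleftrightarrow> x \<in> verts G \<and> y \<in> verts G \<and> x \<noteq> y" for x y
    using assms(1) ddist_le_diam[of x y] ddist_eq_0_iff[of x y] ddist_eq_1_iff[of x y]
      arcs_endsD[of x y] by fastforce
  obtain f where f: "bij_betw f (verts G) {..<n}"
    using ex_bij_betw_finite_nat[OF finite_verts] assms(2) by (metis atLeast0LessThan)
  have "map_prod f f ` arcs_ends G = parcs (standard_complete n)"
  proof (intro equalityI subsetI)
    fix p assume "p \<in> map_prod f f ` arcs_ends G"
    then show "p \<in> parcs (standard_complete n)"
      using f arc by (auto simp: standard_complete_def bij_betw_def dest: inj_onD)
  next
    fix p assume "p \<in> parcs (standard_complete n)"
    then obtain i j where p: "p = (i, j)" "i \<in> {..<n}" "j \<in> {..<n}" "i \<noteq> j"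
      by (auto simp: standard_complete_def)
    then have "i \<in> f ` verts G" "j \<in> f ` verts G"
      by (simp_all only: bij_betw_imp_surj_on[OF f])
    then obtain x y where xy: "x \<in> verts G" "y \<in> verts G" "i = f x" "j = f y" by auto
    then have "(x, y) \<in> arcs_ends G" using p arc by blast
    then show "p \<in> map_prod f f ` arcs_ends G" unfolding p(1) xy by (rule rev_image_eqI) simp
  qed
  then show ?thesis using f by (intro digraph_iso_pairI[of f]) (simp_all add: standard_complete_def)
qed

end

section \<open>Assembling the theorem\<close>

lemma card_parcs_standard_complete: "card (parcs (standard_complete (k + 1))) = k * (k + 1)"
proof -
  have "parcs (standard_complete (k + 1))
      = {(i, j). i \<in> {..<k + 1} \<and> j \<in> {..<k + 1} \<and> i \<noteq> j}"
    by (auto simp: standard_complete_def)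
  then have "card (parcs (standard_complete (k + 1))) = (k + 1) * (k + 1) - (k + 1)"
    by (simp only: card_offdiag finite_lessThan card_lessThan)
  then show ?thesis by simp
qed

lemma card_pverts_Gamma_bar: "card (pverts (Gamma_bar_digraph k d)) = k + d ^ (2 * k)"
proof -
  have "card (pverts (Gamma_bar_digraph k d)) = card (U ` {1..k}) + card (Tup ` tuples k d)"
    unfolding Gamma_bar_digraph_def Gamma_digraph_def
    by (simp, rule card_Un_disjoint) (auto simp: finite_tuples)
  then show ?thesis by (simp add: card_image inj_on_def card_tuples)
qed

lemma Gamma_bar_1: "Gamma_bar_digraph 1 d = Gamma_digraph 1 d"
  unfolding Gamma_bar_digraph_def by (rule pair_pre_digraph.equality) auto

theorem theorem2p8:
  fixes G :: "('a, 'b) pre_digraph" and k d :: nat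
  assumes "k \<ge> 1" and "d \<ge> 1"
    and "digraph G" and "strongly_connected G"
    and "pre_digraph.weak_dim G = k"
    and "pre_digraph.diam G = d"
  shows "k + d \<le> card (arcs G)
    \<and> real (card (arcs G)) \<le> ((real d ^ 2 + 3 * real d - 2) / 2) ^ (2 * k)
        + (2 * real k - real d) * real d ^ (2 * k - 1) + real k ^ 2 - real k
    \<and> (card (arcs G) = k + d \<longleftrightarrow>
        k = 1 \<and> digraph_iso G (with_proj (directed_cycle (d + 1))))
    \<and> (real (card (arcs G)) = ((real d ^ 2 + 3 * real d - 2) / 2) ^ (2 * k)
        + (2 * real k - real d) * real d ^ (2 * k - 1) + real k ^ 2 - real k \<longleftrightarrow>
        (k = 1 \<and> digraph_iso G (with_proj (Gamma_digraph 1 d)))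
      \<or> (d = 1 \<and> digraph_iso G (with_proj (standard_complete (k + 1))))
      \<or> (d = 2 \<and> digraph_iso G (with_proj (Gamma_bar_digraph k 2))))"
proof -
  interpret digraph G by (rule assms(3))
  interpret strong_digraph G by unfold_locales (rule assms(4))
  let ?N = "((real d ^ 2 + 3 * real d - 2) / 2) ^ (2 * k)
        + (2 * real k - real d) * real d ^ (2 * k - 1) + real k ^ 2 - real k"
  let ?C = "(k = 1 \<and> digraph_iso G (with_proj (Gamma_digraph 1 d)))
      \<or> (d = 1 \<and> digraph_iso G (with_proj (standard_complete (k + 1))))
      \<or> (d = 2 \<and> digraph_iso G (with_proj (Gamma_bar_digraph k 2)))"
  have k: "weak_dim = k" and d: "diam = d" using assms by auto
  note N = card_parcs_Gamma_bar[OF assms(2,1)]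
  have lower: "k + d \<le> card (arcs G)"
    using weak_dim_add_diam_le card_verts_le_card_arcs assms(2) k d by simp
  have upper: "real (card (arcs G)) \<le> ?N"
    using card_arcs_le_Gamma_bar unfolding k d N[symmetric] by simp
  have cycle: "card (arcs G) = k + d \<longleftrightarrow>
      k = 1 \<and> digraph_iso G (with_proj (directed_cycle (d + 1)))"
  proof
    assume "card (arcs G) = k + d"
    then show "k = 1 \<and> digraph_iso G (with_proj (directed_cycle (d + 1)))"
      using few_arcs_cycle assms(1,2) unfolding k d by blast
  next
    assume iso: "k = 1 \<and> digraph_iso G (with_proj (directed_cycle (d + 1)))"
    then have "card (arcs G) = card (parcs (directed_cycle (d + 1)))"
      using digraph_iso_card_arcs by fastforce
    then show "card (arcs G) = k + d" using iso by (simp add: card_parcs_directed_cycle)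
  qed
  have "real (card (arcs G)) = ?N \<longleftrightarrow> ?C"
  proof
    assume "real (card (arcs G)) = ?N"
    then have "card (arcs G) = card (parcs (Gamma_bar_digraph k d))" unfolding N[symmetric] by simp
    then have iso: "digraph_iso G (with_proj (Gamma_bar_digraph k d))"
      and verts: "card (verts G) = card (pverts (Gamma_bar_digraph k d))"
      and "k = 1 \<or> d \<le> 2"
      using card_arcs_eq_Gamma_barD assms(1,2) unfolding k d by auto
    then consider "k = 1" | "d = 1" | "d = 2" using assms(2) by linarith
    then show ?C
    proof cases
      case 1
      then show ?thesis using iso unfolding 1 Gamma_bar_1 by simp
    next
      case 2
      \<comment> \<open>For d = 1 there is only one tuple besides the k vertices
        \<open>U i\<close>.\<close>
      then have "card (verts G) = k + 1" using verts by (simp add: card_pverts_Gamma_bar)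
      then show ?thesis using diam_1_complete 2 d by simp
    next
      case 3
      then show ?thesis using iso by simp
    qed
  next
    assume ?C
    \<comment> \<open>Cases (a) and (c) are both instances of the extremal digraph, whose arc count
      is the bound.\<close>
    then consider "digraph_iso G (with_proj (Gamma_bar_digraph k d))"
      | "d = 1" "digraph_iso G (with_proj (standard_complete (k + 1)))"
      using Gamma_bar_1 by auto
    then show "real (card (arcs G)) = ?N"
    proof cases
      case 1
      then show ?thesis using N digraph_iso_card_arcs[OF 1] by simp
    next
      case 2
      \<comment> \<open>For d = 1 the bound is 1 + (2k - 1) + k^2 - k = k(k + 1).\<close>
      then show ?thesis using digraph_iso_card_arcs[OF 2(2)] card_parcs_standard_complete[of k]
        by (simp add: algebra_simps power2_eq_square)
    qed
  qed
  with lower upper cycle show ?thesis by blast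
qed

end
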